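(* Let $T$ be a quasi-rigid continuous map on a Polish space $X$. Then $\mathcal{G}(T)$ is a normal subgroup of $\Omega(T)\cap\mathrm{Homeo}(X)$. Furthermore, if $X$ is a separable $F$-space and $T$ is a quasi-rigid continuous linear operator on $X$, then $\mathcal{G}(T)$ (in its linear version) is a normal subgroup of $\Omega(T)\cap\mathrm{GL}(X)$.
   Context: $\mathrm{Homeo}(X)$ is the group of homeomorphisms of $X$ onto itself; an $F$-space is a completely metrizable topological vector space; $\mathcal{L}(X)$ is the space of continuous linear operators on $X$ and $\mathrm{GL}(X)$ the group of invertible elements of $\mathcal{L}(X)$. Metric setting: $\Sigma(S)$, for a continuous map $S:Y\to Y$, is the set of continuous maps $g:Y\to Y$ such that the set of $y\in Y$ for which there is a strictly increasing sequence of positive integers $(\omega_n)_n$ with $S^{\omega_n}y\to g(y)$ is dense in $Y$. $\Omega(T)$ is the set of continuous maps $h:X\to X$ for which there is a single strictly increasing sequence of positive integers $(\omega_n)_n$ such that $\{x\in X:T^{\omega_n}x\to h(x)\}$ is dense in $X$. In the linear setting ($F$-spaces, $T$ linear), $\Sigma$ and $\Omega$ denote the subsets consisting of continuous linear operators with these properties. $T$ is quasi-rigid if $\mathrm{Id}\in\Omega(T)$. A collection $\{h_\ell\}_{\ell\in J}$ of continuous maps on $X$ (continuous linear operators in the linear setting) is simultaneously approximated by $T$ if for every $n\in\mathbb{N}$ and all members $g_1,\dots,g_n$ of the collection (repetitions allowed), the coordinatewise map $(g_1,\dots,g_n):X^n\to X^n$ belongs to $\Sigma\left(\bigoplus_{i=1}^nT\right)$,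 where $\bigoplus_{i=1}^nT$ acts coordinatewise on $X^n$. For quasi-rigid $T$, $\mathcal{G}(T)$ denotes the unique maximal (for inclusion) collection containing $\mathrm{Id}$ among those simultaneously approximated by $T$ and contained in $\Omega(T)\cap\mathrm{Homeo}(X)$; in the linear setting, $\mathcal{G}(T)$ denotes the unique maximal collection containing $\mathrm{Id}$ among those simultaneously approximated by $T$ and contained in $\Omega(T)\cap\mathrm{GL}(X)$. *)

theory Defs
  imports "HOL-Analysis.Analysis" "HOL-Algebra.Coset"
begin

section \<open>Limit maps along iterates\<close>

text \<open>
  \<open>Sigma_maps\<close> is stated for an arbitrary topology \<open>Y\<close>, because it is needed on all finite powers
  \<open>X\<^sup>n\<close>. The sequence \<open>\<omega>\<close> may depend on the point in \<open>Sigma_maps\<close>, but not in \<open>Omega_maps\<close>.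
\<close>

definition Sigma_maps :: "'a topology \<Rightarrow> ('a \<Rightarrow> 'a) \<Rightarrow> ('a \<Rightarrow> 'a) set" where
  "Sigma_maps Y S = {g. continuous_map Y Y g \<and>
     Y closure_of {y \<in> topspace Y. \<exists>\<omega> :: nat \<Rightarrow> nat. strict_mono \<omega> \<and> (\<forall>n. 0 < \<omega> n) \<and>
       limitin Y (\<lambda>n. (S ^^ \<omega> n) y) (g y) sequentially} = topspace Y}"

definition Omega_maps :: "('a::topological_space \<Rightarrow> 'a) \<Rightarrow> ('a \<Rightarrow> 'a) set" where
  "Omega_maps T = {h. continuous_on UNIV h \<and>
     (\<exists>\<omega> :: nat \<Rightarrow> nat. strict_mono \<omega> \<and> (\<forall>n. 0 < \<omega> n) \<and>
       closure {x. (\<lambda>n. (T ^^ \<omega> n) x) \<longlonglongrightarrow> h x} = UNIV)}"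

definition quasi_rigid :: "('a::topological_space \<Rightarrow> 'a) \<Rightarrow> bool" where
  "quasi_rigid T \<longleftrightarrow> id \<in> Omega_maps T"

definition Homeo :: "('a::topological_space \<Rightarrow> 'a) set" where
  "Homeo = {h. \<exists>k. homeomorphism UNIV UNIV h k}"


section \<open>Simultaneous approximation\<close>

text \<open>The power \<open>X\<^sup>n\<close> consists of the extensional functions on \<open>{..<n}\<close>.\<close>

definition power_space :: "nat \<Rightarrow> (nat \<Rightarrow> 'a::topological_space) topology" where
  "power_space n = product_topology (\<lambda>_. euclidean) {..<n}"

definition power_map :: "nat \<Rightarrow> (nat \<Rightarrow> 'a \<Rightarrow> 'a) \<Rightarrow> (nat \<Rightarrow> 'a) \<Rightarrow> (nat \<Rightarrow> 'a)" where
  "power_map n g = (\<lambda>x. \<lambda>i\<in>{..<n}. g i (x i))"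

definition simultaneously_approximated ::
    "('a::topological_space \<Rightarrow> 'a) \<Rightarrow> ('a \<Rightarrow> 'a) set \<Rightarrow> bool" where
  "simultaneously_approximated T F \<longleftrightarrow>
     (\<forall>h\<in>F. continuous_on UNIV h) \<and>
     (\<forall>n>0. \<forall>g. (\<forall>i<n. g i \<in> F) \<longrightarrow>
        power_map n g \<in> Sigma_maps (power_space n) (power_map n (\<lambda>_. T)))"

definition is_maximal_collection :: "(('a \<Rightarrow> 'a) set \<Rightarrow> bool) \<Rightarrow> ('a \<Rightarrow> 'a) set \<Rightarrow> bool" where
  "is_maximal_collection P F \<longleftrightarrow> P F \<and> (\<forall>F'. P F' \<and> F \<subseteq> F' \<longrightarrow> F' = F)"

definition G_maps :: "('a::topological_space \<Rightarrow> 'a) \<Rightarrow> ('a \<Rightarrow> 'a) set" where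
  "G_maps T = (THE F. is_maximal_collection
     (\<lambda>F. id \<in> F \<and> simultaneously_approximated T F \<and> F \<subseteq> Omega_maps T \<inter> Homeo) F)"

text \<open>A set of self-maps with composition; that it is a group is not built in.\<close>

definition comp_monoid :: "('a \<Rightarrow> 'a) set \<Rightarrow> ('a \<Rightarrow> 'a) monoid" where
  "comp_monoid C = \<lparr>carrier = C, mult = (\<circ>), one = id\<rparr>"


section \<open>The linear setting\<close>

text \<open>
  A field of sort \<open>real_normed_field\<close> has a multiplicative norm and is a real algebra, hence is
  isomorphic, as a topological field, to the reals or to the complex numbers; so real and complex
  F-spaces are both covered. The metric of the class \<open>polish_space\<close> only witnesses that the topology
  is separable and completely metrizable: it need not be translation invariant.
\<close>

locale separable_F_space = vector_space smul
  for smul :: "'k::real_normed_field \<Rightarrow> 'a::{polish_space, topological_ab_group_add} \<Rightarrow> 'a" +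
  assumes continuous_scale: "continuous_on UNIV (\<lambda>(c, x). smul c x)"

definition operators ::
    "('k::field \<Rightarrow> 'a::{topological_space, ab_group_add} \<Rightarrow> 'a) \<Rightarrow> ('a \<Rightarrow> 'a) set" where
  "operators smul = {A. Vector_Spaces.linear smul smul A \<and> continuous_on UNIV A}"

definition GL ::
    "('k::field \<Rightarrow> 'a::{topological_space, ab_group_add} \<Rightarrow> 'a) \<Rightarrow> ('a \<Rightarrow> 'a) set" where
  "GL smul = {A \<in> operators smul. \<exists>B \<in> operators smul. A \<circ> B = id \<and> B \<circ> A = id}"

definition Omega_ops ::
    "('k::field \<Rightarrow> 'a::{topological_space, ab_group_add} \<Rightarrow> 'a) \<Rightarrow> ('a \<Rightarrow> 'a) \<Rightarrow> ('a \<Rightarrow> 'a) set" where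
  "Omega_ops smul T = Omega_maps T \<inter> operators smul"

definition quasi_rigid_op ::
    "('k::field \<Rightarrow> 'a::{topological_space, ab_group_add} \<Rightarrow> 'a) \<Rightarrow> ('a \<Rightarrow> 'a) \<Rightarrow> bool" where
  "quasi_rigid_op smul T \<longleftrightarrow> id \<in> Omega_ops smul T"

text \<open>Linearity of a self-map of \<open>X\<^sup>n\<close> for the coordinatewise vector space structure.\<close>

definition power_linear ::
    "('k::field \<Rightarrow> 'a::ab_group_add \<Rightarrow> 'a) \<Rightarrow> nat \<Rightarrow> ((nat \<Rightarrow> 'a) \<Rightarrow> (nat \<Rightarrow> 'a)) \<Rightarrow> bool" where
  "power_linear smul n A \<longleftrightarrow>
     (\<forall>x \<in> {..<n} \<rightarrow>\<^sub>E UNIV. \<forall>y \<in> {..<n} \<rightarrow>\<^sub>E UNIV.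
        A (\<lambda>i\<in>{..<n}. x i + y i) = (\<lambda>i\<in>{..<n}. A x i + A y i)) \<and>
     (\<forall>c. \<forall>x \<in> {..<n} \<rightarrow>\<^sub>E UNIV.
        A (\<lambda>i\<in>{..<n}. smul c (x i)) = (\<lambda>i\<in>{..<n}. smul c (A x i)))"

definition simultaneously_approximated_ops ::
    "('k::field \<Rightarrow> 'a::{topological_space, ab_group_add} \<Rightarrow> 'a) \<Rightarrow> ('a \<Rightarrow> 'a) \<Rightarrow> ('a \<Rightarrow> 'a) set \<Rightarrow> bool" where
  "simultaneously_approximated_ops smul T F \<longleftrightarrow>
     F \<subseteq> operators smul \<and>
     (\<forall>n>0. \<forall>g. (\<forall>i<n. g i \<in> F) \<longrightarrow>
        power_map n g \<in> {A \<in> Sigma_maps (power_space n) (power_map n (\<lambda>_. T)). power_linear smul n A})"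

definition G_ops ::
    "('k::field \<Rightarrow> 'a::{topological_space, ab_group_add} \<Rightarrow> 'a) \<Rightarrow> ('a \<Rightarrow> 'a) \<Rightarrow> ('a \<Rightarrow> 'a) set" where
  "G_ops smul T = (THE F. is_maximal_collection
     (\<lambda>F. id \<in> F \<and> simultaneously_approximated_ops smul T F \<and> F \<subseteq> Omega_ops smul T \<inter> GL smul) F)"

end

theory Submission
  imports Defs
begin

text \<open>
  Everything rests on a neighbourhood criterion. A tuple \<open>(g\<^sub>0, \<dots>, g\<^sub>n\<^sub>-\<^sub>1)\<close> is called approximated by
  \<open>T\<close> if, whenever \<open>g\<^sub>i\<close> maps some point of the open set \<open>W\<^sub>i\<close> into the open set \<open>V\<^sub>i\<close> for all \<open>i\<close>, some
  arbitrarily large common iterate of \<open>T\<close> does so too. If \<open>T\<close> is continuous and the space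
  is Polish, Baire's theorem in the space of sequences shows that a collection of continuous maps
  is simultaneously approximated iff all its tuples are approximated (\<open>simultaneously_approximated_iff\<close>), and that a continuous \<open>h\<close> lies in \<open>\<Omega>(T)\<close> iff all
  constant tuples \<open>(h, \<dots>, h)\<close> are (\<open>Omega_maps_iff\<close>); in the second case one generic
  sequence of points provides both the dense set and the common sequence of times.

  Approximated tuples of homeomorphisms can be composed coordinatewise (\<open>approximates_comp\<close>): the
  iterates just follow each other. If the identity tuples are approximated, then tuples can also be
  inverted (\<open>approximates_inverse\<close>): if \<open>T\<^sup>m\<close> moves \<open>x\<close> close to \<open>g x\<close> and \<open>T\<^sup>p\<close> with \<open>p > m\<close> brings it
  back to near \<open>x\<close>, then \<open>T\<^sup>p\<^sup>-\<^sup>m\<close> moves \<open>T\<^sup>m x\<close>, a point close to \<open>g x\<close>, to near \<open>x\<close>.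

  Fix a group \<open>C\<close> of homeomorphisms and call a collection admissible if it contains the identity, is
  simultaneously approximated and is contained in \<open>\<Omega>(T) \<inter> C\<close>. Then \<open>\<Omega>(T) \<inter> C\<close> is a group. If \<open>F\<close> and
  \<open>F'\<close> are admissible, so are \<open>{f \<circ> f'}\<close>, which contains both, the set of inverses of \<open>F\<close>, and the
  conjugates of \<open>F\<close> by elements of \<open>\<Omega>(T) \<inter> C\<close>. Hence the admissible collections are directed,
  their union is the largest one, and it is closed under products, inverses and conjugation.
  The linear case is the one where \<open>C\<close> is the group of invertible operators.
\<close>

section \<open>Approximated tuples\<close>

text \<open>Only the maps \<open>g i\<close> with \<open>i < n\<close> matter.\<close>

definition approximates :: "('a::topological_space \<Rightarrow> 'a) \<Rightarrow> nat \<Rightarrow> (nat \<Rightarrow> 'a \<Rightarrow> 'a) \<Rightarrow> bool" where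
  "approximates T n g \<longleftrightarrow>
     (\<forall>W V. (\<forall>i<n. open (W i) \<and> open (V i) \<and> (\<exists>a\<in>W i. g i a \<in> V i)) \<longrightarrow>
        (\<forall>N. \<exists>m>N. \<forall>i<n. \<exists>x\<in>W i. (T ^^ m) x \<in> V i))"

lemma approximatesD:
  assumes "approximates T n g"
    and "\<And>i. i < n \<Longrightarrow> open (W i)" "\<And>i. i < n \<Longrightarrow> open (V i)"
    and "\<And>i. i < n \<Longrightarrow> \<exists>a\<in>W i. g i a \<in> V i"
  obtains m where "m > N" "\<And>i. i < n \<Longrightarrow> \<exists>x\<in>W i. (T ^^ m) x \<in> V i"
proof -
  have "\<forall>i<n. open (W i) \<and> open (V i) \<and> (\<exists>a\<in>W i. g i a \<in> V i)"
    using assms(2-4) by simp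
  then have "\<exists>m>N. \<forall>i<n. \<exists>x\<in>W i. (T ^^ m) x \<in> V i"
    using assms(1)[unfolded approximates_def, THEN spec[of _ W], THEN spec[of _ V]] by simp
  then show ?thesis using that by blast
qed

lemma continuous_on_funpow:
  fixes T :: "'a::topological_space \<Rightarrow> 'a"
  assumes "continuous_on UNIV T"
  shows "continuous_on UNIV (T ^^ m)"
proof (induction m)
  case (Suc m)
  then show ?case
    using assms by (auto intro!: continuous_on_compose2[of UNIV T UNIV "T ^^ m"])
qed (simp add: id_def)

lemma approximates_comp:
  assumes T: "continuous_on UNIV T"
    and g: "approximates T n g" and h: "approximates T n h"
    and h_open: "\<And>i U. i < n \<Longrightarrow> open U \<Longrightarrow> open (h i ` U)"
  shows "approximates T n (\<lambda>i. g i \<circ> h i)"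
  unfolding approximates_def
proof (intro allI impI)
  fix W V N
  assume H: "\<forall>i<n. open (W i) \<and> open (V i) \<and> (\<exists>a\<in>W i. (g i \<circ> h i) a \<in> V i)"
  obtain m where m: "m > N" "\<And>i. i < n \<Longrightarrow> \<exists>x\<in>h i ` W i. (T ^^ m) x \<in> V i"
  proof (rule approximatesD[OF g, of "\<lambda>i. h i ` W i" V N])
    show "\<exists>a\<in>h i ` W i. g i a \<in> V i" if "i < n" for i
      using H that by simp
    show "open (h i ` W i)" "open (V i)" if "i < n" for i
      using H h_open that by blast+
  qed blast
  obtain p where p: "p > N" "\<And>i. i < n \<Longrightarrow> \<exists>x\<in>W i. (T ^^ p) x \<in> (T ^^ m) -` V i"
  proof (rule approximatesD[OF h, of W "\<lambda>i. (T ^^ m) -` V i" N])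
    show "open ((T ^^ m) -` V i)" if "i < n" for i
      using H that continuous_on_funpow[OF T] by (simp add: open_vimage)
  qed (use H m in auto)
  have "\<forall>i<n. \<exists>x\<in>W i. (T ^^ (m + p)) x \<in> V i"
    using p(2) by (simp add: funpow_add)
  then show "\<exists>m>N. \<forall>i<n. \<exists>x\<in>W i. (T ^^ m) x \<in> V i"
    using m(1) by (intro exI[of _ "m + p"]) auto
qed

lemma approximates_inverse:
  assumes T: "continuous_on UNIV T"
    and g: "approximates T n g" and id: "approximates T n (\<lambda>_. id)"
    and g_cont: "\<And>i. i < n \<Longrightarrow> continuous_on UNIV (g i)"
    and gk: "\<And>i x. i < n \<Longrightarrow> g i (k i x) = x"
  shows "approximates T n k"
  unfolding approximates_def
proof (intro allI impI)
  fix W V N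
  assume H: "\<forall>i<n. open (W i) \<and> open (V i) \<and> (\<exists>a\<in>W i. k i a \<in> V i)"
  \<comment> \<open>If \<open>a \<in> W i\<close> and \<open>k i a \<in> V i\<close>, then \<open>A i\<close> is a neighbourhood of \<open>k i a\<close>, which \<open>g i\<close> maps to \<open>a\<close>.\<close>
  define A where "A i = V i \<inter> g i -` W i" for i
  have A: "open (A i)" "\<exists>a\<in>A i. g i a \<in> W i" if i: "i < n" for i
    using H g_cont[OF i] gk[OF i] i unfolding A_def by (force intro: open_vimage)+
  obtain m where m: "\<And>i. i < n \<Longrightarrow> \<exists>x\<in>A i. (T ^^ m) x \<in> W i"
    by (rule approximatesD[OF g, of A W 0]) (use A H in auto)
  \<comment> \<open>Points of \<open>B i\<close> reach \<open>W i\<close> at time \<open>m\<close>; those that return to \<open>B i\<close> at time \<open>p\<close> then lie in \<open>V i\<close>.\<close>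
  define B where "B i = A i \<inter> (T ^^ m) -` W i" for i
  have B: "open (B i)" "\<exists>a\<in>B i. id a \<in> B i" if i: "i < n" for i
    using H A[OF i] m[OF i] i continuous_on_funpow[OF T]
    unfolding B_def by (force intro: open_vimage)+
  obtain p where p: "p > m + N" "\<And>i. i < n \<Longrightarrow> \<exists>x\<in>B i. (T ^^ p) x \<in> B i"
    by (rule approximatesD[OF id, of B B "m + N"]) (use B in auto)
  have split: "(T ^^ (p - m)) ((T ^^ m) y) = (T ^^ p) y" for y
    using p(1) funpow_add[of "p - m" m T] by simp
  have "\<exists>x\<in>W i. (T ^^ (p - m)) x \<in> V i" if i: "i < n" for i
  proof -
    obtain y where "y \<in> B i" "(T ^^ p) y \<in> B i"
      using p(2)[OF i] by blast
    then show ?thesis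
      unfolding A_def B_def by (intro bexI[of _ "(T ^^ m) y"]) (auto simp: split)
  qed
  then show "\<exists>m>N. \<forall>i<n. \<exists>x\<in>W i. (T ^^ m) x \<in> V i"
    using p(1) by (intro exI[of _ "p - m"]) auto
qed


section \<open>Generic sequences of points\<close>

lemma open_fun_contains_box:
  fixes U :: "(nat \<Rightarrow> 'a::topological_space) set"
  assumes "open U" "x \<in> U"
  obtains X k where "\<And>i. open (X i)" "\<And>i. x i \<in> X i" "\<And>z. (\<And>i. i < k \<Longrightarrow> z i \<in> X i) \<Longrightarrow> z \<in> U"
proof -
  obtain X where X: "x \<in> Pi\<^sub>E UNIV X" "\<And>i. open (X i)" "finite {i. X i \<noteq> UNIV}" "Pi\<^sub>E UNIV X \<subseteq> U"
    using product_topology_open_contains_basis[of "\<lambda>_. euclidean" UNIV U x] assms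
    unfolding open_fun_def by auto
  obtain k where k: "\<forall>i\<in>{i. X i \<noteq> UNIV}. i < k"
    using X(3) unfolding finite_nat_set_iff_bounded ..
  show ?thesis
  proof (rule that[of X k])
    show "z \<in> U" if "\<And>i. i < k \<Longrightarrow> z i \<in> X i" for z
    proof -
      have "z i \<in> X i" for i
        using that[of i] k by (cases "X i = UNIV") auto
      then have "z \<in> Pi\<^sub>E UNIV X" by auto
      then show ?thesis using X(4) by blast
    qed
  qed (use X in auto)
qed

text \<open>
  \<open>R k\<close> is the set of sequences whose first \<open>k\<close> entries are moved close to their images under \<open>g\<close> by
  a common iterate of order more than \<open>k\<close>. Being open and dense, these sets can be intersected by
  Baire's theorem.
\<close>

lemma generic_near_limit:
  fixes T :: "'a::metric_space \<Rightarrow> 'a"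
  assumes T: "continuous_on UNIV T" and g: "\<And>i. continuous_on UNIV (g i)"
    and appr: "\<And>n. approximates T n g"
  defines "R k \<equiv> (\<Union>m\<in>{k<..}. \<Inter>i\<in>{..<k}. {x. dist ((T ^^ m) (x i)) (g i (x i)) < inverse (Suc k)})"
  shows "open (R k)" "closure (R k) = UNIV"
proof -
  have cont: "continuous_on UNIV (\<lambda>x::nat \<Rightarrow> 'a. f (x i))" if "continuous_on UNIV f"
    for f :: "'a \<Rightarrow> 'a" and i
    using that by (auto intro!: continuous_on_compose2[of UNIV f UNIV "\<lambda>x. x i"])
  show "open (R k)"
    unfolding R_def
    by (intro open_UN open_INT ballI finite_lessThan open_Collect_less continuous_intros
        cont g continuous_on_funpow T)
  have "\<exists>z\<in>R k. z \<in> U" if U: "open U" "x \<in> U" for x :: "nat \<Rightarrow> 'a" and U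
  proof -
    obtain X l where X: "\<And>i. open (X i)" "\<And>i. x i \<in> X i"
        "\<And>z. (\<And>i. i < l \<Longrightarrow> z i \<in> X i) \<Longrightarrow> z \<in> U"
      using open_fun_contains_box[OF U] by metis
    define e where "e = inverse (real (Suc k)) / 2"
    have e: "e > 0" by (simp add: e_def)
    define V where "V i = ball (g i (x i)) e" for i
    define W where "W i = X i \<inter> g i -` V i" for i
    obtain m where m: "m > k" "\<And>i. i < max k l \<Longrightarrow> \<exists>y\<in>W i. (T ^^ m) y \<in> V i"
    proof (rule approximatesD[OF appr, of "max k l" W V k])
      show "open (W i)" for i
        unfolding W_def V_def using X(1) g by (intro open_Int open_vimage) auto
      show "\<exists>a\<in>W i. g i a \<in> V i" for i
        using X(2) e unfolding W_def V_def by (intro bexI[of _ "x i"]) auto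
    qed (auto simp: V_def)
    then obtain y where y: "\<And>i. i < max k l \<Longrightarrow> y i \<in> W i \<and> (T ^^ m) (y i) \<in> V i"
      by metis
    have "y \<in> U"
      using y unfolding W_def by (intro X(3)) auto
    moreover have "dist ((T ^^ m) (y i)) (g i (y i)) < inverse (Suc k)" if "i < k" for i
    proof -
      have "dist (g i (x i)) ((T ^^ m) (y i)) < e" "dist (g i (x i)) (g i (y i)) < e"
        using y[of i] that unfolding W_def V_def by auto
      then show ?thesis
        using dist_triangle3[of "(T ^^ m) (y i)" "g i (y i)" "g i (x i)"] unfolding e_def by linarith
    qed
    ultimately show ?thesis
      using m(1) unfolding R_def by (intro bexI[of _ y]) auto
  qed
  then show "closure (R k) = UNIV"
    by (auto simp: closure_iff_nhds_not_empty) blast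
qed

text \<open>With \<open>B\<close> running through a countable basis, this makes the range of a generic sequence dense.\<close>

lemma generic_meets_open:
  fixes B :: "'a::topological_space set"
  assumes "open B" "B \<noteq> {}"
  defines "D \<equiv> (\<Union>i::nat. (\<lambda>x. x i) -` B)"
  shows "open D" "closure D = UNIV"
proof -
  show "open D"
    unfolding D_def using assms by (intro open_UN ballI open_vimage) auto
  obtain b where b: "b \<in> B" using assms by blast
  have "\<exists>z\<in>D. z \<in> U" if U: "open U" "x \<in> U" for x :: "nat \<Rightarrow> 'a" and U
  proof -
    obtain X l where X: "\<And>i. open (X i)" "\<And>i. x i \<in> X i"
        "\<And>z. (\<And>i. i < l \<Longrightarrow> z i \<in> X i) \<Longrightarrow> z \<in> U"
      using open_fun_contains_box[OF U] by metis
    have "x(l := b) \<in> U" by (rule X(3)) (use X(2) in auto)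
    moreover have "x(l := b) \<in> D" using b unfolding D_def by auto
    ultimately show ?thesis by blast
  qed
  then show "closure D = UNIV"
    by (auto simp: closure_iff_nhds_not_empty) blast
qed

lemma limit_along_times:
  fixes T :: "'a::metric_space \<Rightarrow> 'a" and x :: "nat \<Rightarrow> 'a"
  assumes "\<And>k. \<exists>m>k. \<forall>i<k. dist ((T ^^ m) (x i)) (g i (x i)) < inverse (Suc k)"
  shows "\<exists>\<omega> :: nat \<Rightarrow> nat. strict_mono \<omega> \<and> (\<forall>k. 0 < \<omega> k) \<and>
           (\<forall>i. (\<lambda>k. (T ^^ \<omega> k) (x i)) \<longlonglongrightarrow> g i (x i))"
proof -
  obtain m where m: "\<And>k. m k > k"
      "\<And>k i. i < k \<Longrightarrow> dist ((T ^^ m k) (x i)) (g i (x i)) < inverse (Suc k)"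
    using assms by metis
  \<comment> \<open>Since \<open>m k > k\<close>, iterating \<open>m\<close> makes the times strictly increasing.\<close>
  define j where "j k = (m ^^ k) 0" for k
  have j: "strict_mono j" "\<And>k. k \<le> j k"
    unfolding j_def using m(1) by (auto simp: strict_mono_Suc_iff intro: strict_mono_imp_increasing)
  have mono: "strict_mono (\<lambda>k. m (j k))"
    by (simp add: strict_mono_Suc_iff j_def m(1))
  have "(\<lambda>k. (T ^^ m (j k)) (x i)) \<longlonglongrightarrow> g i (x i)" for i
  proof (subst tendsto_dist_iff, rule tendsto_sandwich[OF _ _ tendsto_const LIMSEQ_inverse_real_of_nat])
    have "dist ((T ^^ m (j k)) (x i)) (g i (x i)) \<le> inverse (real (Suc k))" if "k > i" for k
    proof -
      have "inverse (real (Suc (j k))) \<le> inverse (real (Suc k))"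
        using j(2)[of k] by (intro le_imp_inverse_le) auto
      then show ?thesis
        using m(2)[of i "j k"] j(2)[of k] that by linarith
    qed
    then show "\<forall>\<^sub>F k in sequentially. dist ((T ^^ m (j k)) (x i)) (g i (x i)) \<le> inverse (real (Suc k))"
      using eventually_gt_at_top by (rule eventually_mono[rotated])
  qed auto
  then show ?thesis
    using mono m(1) by (intro exI[of _ "\<lambda>k. m (j k)"]) (auto intro: le_less_trans)
qed

text \<open>The sequence of times depends on the sequence \<open>x\<close>, but not on the coordinate.\<close>

lemma generic_sequence:
  fixes T :: "'a::polish_space \<Rightarrow> 'a"
  assumes "continuous_on UNIV T" "\<And>i. continuous_on UNIV (g i)" "\<And>n. approximates T n g"
  shows "closure {x. closure (range x) = UNIV \<and>
           (\<exists>\<omega> :: nat \<Rightarrow> nat. strict_mono \<omega> \<and> (\<forall>k. 0 < \<omega> k) \<and>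
              (\<forall>i. (\<lambda>k. (T ^^ \<omega> k) (x i)) \<longlonglongrightarrow> g i (x i)))} = UNIV"
    (is "closure ?good = UNIV")
proof -
  obtain \<B> :: "'a set set" where \<B>: "countable \<B>" "topological_basis \<B>"
    using ex_countable_basis by blast
  define R where "R k = (\<Union>m\<in>{k<..}. \<Inter>i\<in>{..<k}.
      {x. dist ((T ^^ m) (x i)) (g i (x i)) < inverse (Suc k)})" for k
  define D where "D B = (\<Union>i::nat. (\<lambda>x. x i) -` B)" for B :: "'a set"
  define \<G> where "\<G> = range R \<union> D ` (\<B> - {{}})"
  have "euclidean closure_of \<Inter>\<G> = topspace euclidean"
  proof (rule Baire_category)
    show "countable \<G>"
      using \<B>(1) unfolding \<G>_def by auto
    show "openin euclidean G \<and> euclidean closure_of G = topspace euclidean" if "G \<in> \<G>" for G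
    proof -
      have "open G \<and> closure G = UNIV"
      proof (cases "G \<in> range R")
        case True
        then obtain k where "G = R k" by (rule rangeE)
        then show ?thesis
          using generic_near_limit[OF assms, of k] by (simp only: R_def)
      next
        case False
        with that have "G \<in> D ` (\<B> - {{}})" by (simp only: \<G>_def Un_iff simp_thms)
        then obtain B where "G = D B" "B \<in> \<B> - {{}}" by (rule imageE)
        then have "open B" "B \<noteq> {}"
          using topological_basis_open[OF \<B>(2)] by auto
        then show ?thesis
          using generic_meets_open[of B] \<open>G = D B\<close> by (simp only: D_def simp_thms)
      qed
      then show ?thesis by simp
    qed
  qed (simp add: completely_metrizable_space_euclidean)
  then have "closure (\<Inter>\<G>) = UNIV" by simp
  moreover have "\<Inter>\<G> \<subseteq> ?good"
  proof
    fix x assume x: "x \<in> \<Inter>\<G>"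
    have "closure (range x) = UNIV"
    proof (rule ccontr)
      assume "closure (range x) \<noteq> UNIV"
      then obtain y where "y \<in> - closure (range x)" by blast
      then obtain B where B: "B \<in> \<B>" "y \<in> B" "B \<subseteq> - closure (range x)"
        by (rule topological_basisE[OF \<B>(2), rotated]) auto
      then have "D B \<in> \<G>" unfolding \<G>_def by (intro UnI2 imageI) auto
      then have "x \<in> D B" using x by (rule InterD[rotated])
      then show False
        using B(3) closure_subset[of "range x"] unfolding D_def by auto
    qed
    moreover have "\<exists>m>k. \<forall>i<k. dist ((T ^^ m) (x i)) (g i (x i)) < inverse (Suc k)" for k
    proof -
      have "R k \<in> \<G>" unfolding \<G>_def by (intro UnI1 rangeI)
      with x have "x \<in> R k" by (rule InterD)
      then show ?thesis unfolding R_def by auto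
    qed
    ultimately show "x \<in> ?good"
      by (intro CollectI conjI limit_along_times) simp_all
  qed
  ultimately show ?thesis
    using closure_mono[of "\<Inter>\<G>" ?good] by (simp only: top.extremum_unique)
qed


section \<open>The criterion for limit maps and for simultaneous approximation\<close>

lemma Omega_maps_iff:
  fixes T :: "'a::polish_space \<Rightarrow> 'a"
  assumes T: "continuous_on UNIV T"
  shows "h \<in> Omega_maps T \<longleftrightarrow> continuous_on UNIV h \<and> (\<forall>n. approximates T n (\<lambda>_. h))"
proof (intro iffI conjI allI)
  assume h: "h \<in> Omega_maps T"
  then show "continuous_on UNIV h" by (simp add: Omega_maps_def)
  then have vim: "open (h -` V)" if "open V" for V
    using that open_vimage by blast
  obtain \<omega> :: "nat \<Rightarrow> nat" where \<omega>: "strict_mono \<omega>" "closure {x. (\<lambda>n. (T ^^ \<omega> n) x) \<longlonglongrightarrow> h x} = UNIV"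
    using h by (auto simp: Omega_maps_def)
  fix n show "approximates T n (\<lambda>_. h)"
    unfolding approximates_def
  proof (intro allI impI)
    fix W V N
    assume H: "\<forall>i<n. open (W i) \<and> open (V i) \<and> (\<exists>a\<in>W i. h a \<in> V i)"
    have "\<exists>x\<in>W i. h x \<in> V i \<and> (\<lambda>n. (T ^^ \<omega> n) x) \<longlonglongrightarrow> h x" if "i < n" for i
    proof -
      have "open (W i \<inter> h -` V i)" "W i \<inter> h -` V i \<noteq> {}"
        using H vim that by auto
      then have "W i \<inter> h -` V i \<inter> {x. (\<lambda>n. (T ^^ \<omega> n) x) \<longlonglongrightarrow> h x} \<noteq> {}"
        using \<omega>(2) open_Int_closure_eq_empty by fastforce
      then show ?thesis by blast
    qed
    then obtain x where x: "\<And>i. i < n \<Longrightarrow> x i \<in> W i \<and> h (x i) \<in> V i \<and> (\<lambda>n. (T ^^ \<omega> n) (x i)) \<longlonglongrightarrow> h (x i)"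
      by metis
    have "\<forall>\<^sub>F k in sequentially. \<forall>i\<in>{..<n}. (T ^^ \<omega> k) (x i) \<in> V i"
      using x H by (intro eventually_ball_finite ballI) (auto dest: topological_tendstoD)
    then have "\<forall>\<^sub>F k in sequentially. k > N \<and> (\<forall>i\<in>{..<n}. (T ^^ \<omega> k) (x i) \<in> V i)"
      using eventually_gt_at_top eventually_conj by blast
    from eventually_happens'[OF sequentially_bot this] obtain k where
        k: "k > N" "\<forall>i\<in>{..<n}. (T ^^ \<omega> k) (x i) \<in> V i"
      by blast
    then show "\<exists>m>N. \<forall>i<n. \<exists>y\<in>W i. (T ^^ m) y \<in> V i"
      using x strict_mono_imp_increasing[OF \<omega>(1), of k] by (intro exI[of _ "\<omega> k"]) auto
  qed
next
  assume h: "continuous_on UNIV h \<and> (\<forall>n. approximates T n (\<lambda>_. h))"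
  let ?good = "{x :: nat \<Rightarrow> 'a. closure (range x) = UNIV \<and>
           (\<exists>\<omega> :: nat \<Rightarrow> nat. strict_mono \<omega> \<and> (\<forall>k. 0 < \<omega> k) \<and>
              (\<forall>i. (\<lambda>k. (T ^^ \<omega> k) (x i)) \<longlonglongrightarrow> h (x i)))}"
  have "closure ?good = UNIV"
    using h by (intro generic_sequence[OF T, of "\<lambda>_. h"]) simp_all
  then have "?good \<noteq> {}" by (metis closure_empty UNIV_not_empty)
  then obtain x where "x \<in> ?good" by blast
  then obtain \<omega> :: "nat \<Rightarrow> nat" where x: "closure (range x) = UNIV" "strict_mono \<omega>" "\<forall>k. 0 < \<omega> k"
      "\<forall>i. (\<lambda>k. (T ^^ \<omega> k) (x i)) \<longlonglongrightarrow> h (x i)"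
    by blast
  have "closure (range x) \<subseteq> closure {x. (\<lambda>k. (T ^^ \<omega> k) x) \<longlonglongrightarrow> h x}"
    using x(4) by (intro closure_mono) auto
  then have "closure {x. (\<lambda>k. (T ^^ \<omega> k) x) \<longlonglongrightarrow> h x} = UNIV"
    by (simp only: x(1) top.extremum_unique)
  then show "h \<in> Omega_maps T"
    using x(2,3) h unfolding Omega_maps_def by blast
qed

lemma topspace_power_space: "topspace (power_space n) = Pi\<^sub>E {..<n} (\<lambda>_. UNIV)"
  by (simp add: power_space_def)

lemma power_map_in_space: "power_map n g x \<in> topspace (power_space n)"
  by (auto simp: power_map_def topspace_power_space)

lemma power_map_funpow:
  assumes "i < n"
  shows "(power_map n (\<lambda>_. T) ^^ m) y i = (T ^^ m) (y i)"
  using assms by (induction m) (auto simp: power_map_def)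

lemma continuous_map_power_map:
  assumes "\<And>i. i < n \<Longrightarrow> continuous_on UNIV (g i)"
  shows "continuous_map (power_space n) (power_space n) (power_map n g)"
proof -
  have "continuous_map (power_space n) euclidean (\<lambda>x. g i (x i))" if "i < n" for i
  proof -
    have "continuous_map (power_space n) euclidean (\<lambda>x. x i)"
      unfolding power_space_def using that by (intro continuous_map_product_coordinates) simp
    moreover have "continuous_map euclidean euclidean (g i)"
      using assms[OF that] by simp
    ultimately have "continuous_map (power_space n) euclidean (g i \<circ> (\<lambda>x. x i))"
      by (rule continuous_map_compose)
    then show ?thesis by (simp only: o_def)
  qed
  then show ?thesis
    by (subst (2) power_space_def) (auto simp: continuous_map_componentwise power_map_def)
qed

lemma limitin_power_space_iff:
  assumes "\<And>k. 0 < \<omega> k"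
  shows "limitin (power_space n) (\<lambda>k. (power_map n (\<lambda>_. T) ^^ \<omega> k) y) (power_map n g y) sequentially \<longleftrightarrow>
           (\<forall>i<n. (\<lambda>k. (T ^^ \<omega> k) (y i)) \<longlonglongrightarrow> g i (y i))"
proof -
  have "(power_map n (\<lambda>_. T) ^^ \<omega> k) y \<in> topspace (power_space n)" for k
    using assms[of k] power_map_in_space by (cases "\<omega> k") auto
  then show ?thesis
    using power_map_in_space[of n g y]
    by (auto simp: power_space_def limitin_componentwise power_map_funpow PiE_def) (auto simp: power_map_def)
qed

lemma approximates_of_Sigma:
  assumes g: "\<And>i. i < n \<Longrightarrow> continuous_on UNIV (g i)"
    and S: "power_map n g \<in> Sigma_maps (power_space n) (power_map n (\<lambda>_. T))"
  shows "approximates T n g"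
  unfolding approximates_def
proof (intro allI impI)
  fix W V N
  assume H: "\<forall>i<n. open (W i) \<and> open (V i) \<and> (\<exists>a\<in>W i. g i a \<in> V i)"
  then obtain a where a: "\<And>i. i < n \<Longrightarrow> a i \<in> W i \<and> g i (a i) \<in> V i"
    by metis
  define U where "U = Pi\<^sub>E {..<n} (\<lambda>i. W i \<inter> g i -` V i)"
  have U: "openin (power_space n) U"
    unfolding U_def power_space_def using H g
    by (subst openin_PiE) (auto intro!: open_Int open_vimage)
  have aU: "restrict a {..<n} \<in> U" using a unfolding U_def by auto
  then have "restrict a {..<n} \<in> power_space n closure_of {y \<in> topspace (power_space n).
      \<exists>\<omega> :: nat \<Rightarrow> nat. strict_mono \<omega> \<and> (\<forall>k. 0 < \<omega> k) \<and>
       limitin (power_space n) (\<lambda>k. (power_map n (\<lambda>_. T) ^^ \<omega> k) y) (power_map n g y) sequentially}"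
    using S openin_subset[OF U] unfolding Sigma_maps_def by auto
  then obtain y and \<omega> :: "nat \<Rightarrow> nat" where y: "y \<in> U" and \<omega>: "strict_mono \<omega>" "\<forall>k. 0 < \<omega> k"
    "limitin (power_space n) (\<lambda>k. (power_map n (\<lambda>_. T) ^^ \<omega> k) y) (power_map n g y) sequentially"
    using U aU unfolding in_closure_of by blast
  have lim: "(\<lambda>k. (T ^^ \<omega> k) (y i)) \<longlonglongrightarrow> g i (y i)" if "i < n" for i
    using \<omega> that limitin_power_space_iff by blast
  have yi: "y i \<in> W i" "g i (y i) \<in> V i" if "i < n" for i
    using y that unfolding U_def by auto
  have "\<forall>\<^sub>F k in sequentially. \<forall>i\<in>{..<n}. (T ^^ \<omega> k) (y i) \<in> V i"
  proof (intro eventually_ball_finite ballI)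
    show "\<forall>\<^sub>F k in sequentially. (T ^^ \<omega> k) (y i) \<in> V i" if "i \<in> {..<n}" for i
      using topological_tendstoD[OF lim, of i "V i"] yi H that by simp
  qed simp
  then have "\<forall>\<^sub>F k in sequentially. k > N \<and> (\<forall>i\<in>{..<n}. (T ^^ \<omega> k) (y i) \<in> V i)"
    using eventually_gt_at_top eventually_conj by blast
  from eventually_happens'[OF sequentially_bot this] obtain k where
      k: "k > N" "\<forall>i\<in>{..<n}. (T ^^ \<omega> k) (y i) \<in> V i"
    by blast
  then show "\<exists>m>N. \<forall>i<n. \<exists>y\<in>W i. (T ^^ m) y \<in> V i"
    using yi strict_mono_imp_increasing[OF \<omega>(1), of k] by (intro exI[of _ "\<omega> k"]) auto
qed

lemma Sigma_of_approximates:
  fixes T :: "'a::polish_space \<Rightarrow> 'a"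
  assumes T: "continuous_on UNIV T" and g: "\<And>i. continuous_on UNIV (g i)"
    and appr: "\<And>n. approximates T n g"
  shows "power_map n g \<in> Sigma_maps (power_space n) (power_map n (\<lambda>_. T))"
proof -
  define good where "good = {x. closure (range x) = UNIV \<and>
           (\<exists>\<omega> :: nat \<Rightarrow> nat. strict_mono \<omega> \<and> (\<forall>k. 0 < \<omega> k) \<and>
              (\<forall>i. (\<lambda>k. (T ^^ \<omega> k) (x i)) \<longlonglongrightarrow> g i (x i)))}"
  define E where "E = {y \<in> topspace (power_space n). \<exists>\<omega> :: nat \<Rightarrow> nat. strict_mono \<omega> \<and> (\<forall>k. 0 < \<omega> k) \<and>
       limitin (power_space n) (\<lambda>k. (power_map n (\<lambda>_. T) ^^ \<omega> k) y) (power_map n g y) sequentially}"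
  define r where "r x = restrict x {..<n}" for x :: "nat \<Rightarrow> 'a"
  have r: "continuous_map euclidean (power_space n) r"
    unfolding power_space_def r_def by (auto simp: continuous_map_componentwise)
  have rE: "r x \<in> E" if good: "x \<in> good" for x
  proof -
    obtain \<omega> :: "nat \<Rightarrow> nat" where \<omega>: "strict_mono \<omega>" "\<forall>k. 0 < \<omega> k"
        "\<forall>i. (\<lambda>k. (T ^^ \<omega> k) (x i)) \<longlonglongrightarrow> g i (x i)"
      using good unfolding good_def by blast
    then have "limitin (power_space n) (\<lambda>k. (power_map n (\<lambda>_. T) ^^ \<omega> k) (r x)) (power_map n g (r x)) sequentially"
      by (subst limitin_power_space_iff) (auto simp: r_def)
    then show ?thesis
      using \<omega> unfolding E_def by (auto simp: topspace_power_space r_def)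
  qed
  have "x \<in> power_space n closure_of E" if x: "x \<in> topspace (power_space n)" for x
    unfolding in_closure_of
  proof (intro conjI allI impI x, elim conjE)
    fix U assume U: "x \<in> U" "openin (power_space n) U"
    have "open (r -` U)"
      using openin_continuous_map_preimage[OF r U(2)] by (simp add: vimage_def)
    moreover have "x \<in> r -` U"
      using x U(1) by (simp add: r_def topspace_power_space PiE_restrict)
    ultimately have "r -` U \<inter> good \<noteq> {}"
      using generic_sequence[OF assms] open_Int_closure_eq_empty[of "r -` U" good]
      unfolding good_def[symmetric] by blast
    then obtain z where "r z \<in> U" "z \<in> good" by blast
    then show "\<exists>y. y \<in> E \<and> y \<in> U" using rE by blast
  qed
  then have "power_space n closure_of E = topspace (power_space n)"
    by (intro subset_antisym closure_of_subset_topspace subsetI)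
  then show ?thesis
    unfolding Sigma_maps_def E_def using continuous_map_power_map[of n g] g by blast
qed

lemma simultaneously_approximated_iff:
  fixes T :: "'a::polish_space \<Rightarrow> 'a"
  assumes T: "continuous_on UNIV T"
  shows "simultaneously_approximated T F \<longleftrightarrow>
     (\<forall>h\<in>F. continuous_on UNIV h) \<and> (\<forall>g. range g \<subseteq> F \<longrightarrow> (\<forall>n. approximates T n g))"
    (is "?L \<longleftrightarrow> ?R")
proof
  assume L: ?L
  have "approximates T n g" if g: "range g \<subseteq> F" for g n
  proof (cases "n = 0")
    case True
    then show ?thesis by (auto simp: approximates_def)
  next
    case False
    then show ?thesis
      using L g unfolding simultaneously_approximated_def
      by (intro approximates_of_Sigma) blast+
  qed
  then show ?R using L by (auto simp: simultaneously_approximated_def)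
next
  assume R: ?R
  have "power_map n g \<in> Sigma_maps (power_space n) (power_map n (\<lambda>_. T))"
    if n: "n > 0" and g: "\<forall>i<n. g i \<in> F" for n g
  proof -
    \<comment> \<open>The tuple is continued to an infinite sequence in \<open>F\<close> by repeating its first entry.\<close>
    define g' where "g' i = g (if i < n then i else 0)" for i
    have g': "range g' \<subseteq> F" using n g by (auto simp: g'_def)
    have "power_map n g = power_map n g'"
      by (auto simp: power_map_def g'_def fun_eq_iff)
    then show ?thesis
      using Sigma_of_approximates[OF T, of g' n] R g' by auto
  qed
  then show ?L using R by (auto simp: simultaneously_approximated_def)
qed


section \<open>The largest admissible collection\<close>

text \<open>A group of homeomorphisms under composition: all of them, or the invertible operators.\<close>

definition homeo_group :: "('a::topological_space \<Rightarrow> 'a) set \<Rightarrow> bool" where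
  "homeo_group C \<longleftrightarrow> C \<subseteq> Homeo \<and> id \<in> C \<and> (\<forall>f\<in>C. \<forall>g\<in>C. f \<circ> g \<in> C) \<and> (\<forall>f\<in>C. inv_into UNIV f \<in> C)"

text \<open>
  The collections among which \<open>G_maps\<close> and \<open>G_ops\<close> are maximal, with \<open>C\<close> in place of the homeomorphisms
  or invertible operators. Linearity is carried by \<open>C\<close> alone.
\<close>

definition admissible ::
    "('a::topological_space \<Rightarrow> 'a) set \<Rightarrow> ('a \<Rightarrow> 'a) \<Rightarrow> ('a \<Rightarrow> 'a) set \<Rightarrow> bool" where
  "admissible C T F \<longleftrightarrow> id \<in> F \<and> simultaneously_approximated T F \<and> F \<subseteq> Omega_maps T \<inter> C"

lemma HomeoD:
  assumes "h \<in> Homeo"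
  shows "continuous_on UNIV h" "bij h" "open U \<Longrightarrow> open (h ` U)" "continuous_on UNIV (inv_into UNIV h)"
proof -
  obtain k where k: "homeomorphism UNIV UNIV h k"
    using assms unfolding Homeo_def by blast
  then have hk: "h (k x) = x" "k (h x) = x" for x
    by (auto simp: homeomorphism_def)
  show "continuous_on UNIV h" using k by (simp add: homeomorphism_def)
  show bij: "bij h" using hk by (metis bijI')
  have "inv_into UNIV h = k" using hk bij by (metis inv_unique_comp ext comp_apply id_apply)
  then show "continuous_on UNIV (inv_into UNIV h)" using k by (simp add: homeomorphism_def)
  have "h ` U = k -` U" for U
  proof (intro equalityI subsetI)
    show "x \<in> h ` U" if "x \<in> k -` U" for x
      using that hk(1)[of x] by (intro image_eqI[of _ h "k x"]) auto
  qed (auto simp: hk)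
  then show "open (h ` U)" if "open U"
    using that k by (simp add: open_vimage homeomorphism_def)
qed

lemma Homeo_iff:
  "h \<in> Homeo \<longleftrightarrow> bij h \<and> continuous_on UNIV h \<and> continuous_on UNIV (inv_into UNIV h)"
proof
  assume H: "bij h \<and> continuous_on UNIV h \<and> continuous_on UNIV (inv_into UNIV h)"
  then have "homeomorphism UNIV UNIV h (inv_into UNIV h)"
    by (auto simp: homeomorphism_def bij_def image_iff surj_f_inv_f intro: surj_imp_inj_inv)
      (metis inv_f_f)+
  then show "h \<in> Homeo" unfolding Homeo_def by blast
qed (use HomeoD in blast)

lemma homeo_group_Homeo: "homeo_group Homeo"
proof -
  have "f \<circ> g \<in> Homeo" if "f \<in> Homeo" "g \<in> Homeo" for f g :: "'a \<Rightarrow> 'a"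
    using that unfolding Homeo_def by (auto intro: homeomorphism_compose)
  moreover have "inv_into UNIV f \<in> Homeo" if "f \<in> Homeo" for f :: "'a \<Rightarrow> 'a"
    using that by (auto simp: Homeo_iff bij_imp_bij_inv inv_inv_eq)
  moreover have "id \<in> (Homeo :: ('a \<Rightarrow> 'a) set)"
    by (auto simp: Homeo_iff continuous_on_id id_def[symmetric])
  ultimately show ?thesis
    unfolding homeo_group_def by blast
qed

locale quasi_rigid_system =
  fixes T :: "'a::polish_space \<Rightarrow> 'a" and C :: "('a \<Rightarrow> 'a) set"
  assumes T: "continuous_on UNIV T" and rigid: "quasi_rigid T" and C: "homeo_group C"
begin

lemma C_Homeo: "h \<in> C \<Longrightarrow> h \<in> Homeo"
  and C_id: "id \<in> C"
  and C_comp: "f \<in> C \<Longrightarrow> h \<in> C \<Longrightarrow> f \<circ> h \<in> C"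
  and C_inverse: "h \<in> C \<Longrightarrow> inv_into UNIV h \<in> C"
  using C unfolding homeo_group_def by auto

lemma C_bij: "h \<in> C \<Longrightarrow> bij h"
  using C_Homeo HomeoD(2) by auto

lemma Omega_iff:
  assumes "h \<in> C"
  shows "h \<in> Omega_maps T \<longleftrightarrow> (\<forall>n. approximates T n (\<lambda>_. h))"
  using HomeoD(1)[OF C_Homeo[OF assms]] by (simp add: Omega_maps_iff[OF T])

lemma admissible_iff:
  "admissible C T F \<longleftrightarrow>
     id \<in> F \<and> F \<subseteq> Omega_maps T \<inter> C \<and> (\<forall>g. range g \<subseteq> F \<longrightarrow> (\<forall>n. approximates T n g))"
proof -
  have "continuous_on UNIV h" if "F \<subseteq> Omega_maps T \<inter> C" "h \<in> F" for h
    using that C_Homeo HomeoD(1) by blast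
  then show ?thesis
    unfolding admissible_def simultaneously_approximated_iff[OF T] by blast
qed

lemma admissibleI:
  assumes "id \<in> F" "F \<subseteq> Omega_maps T \<inter> C" "\<And>g n. range g \<subseteq> F \<Longrightarrow> approximates T n g"
  shows "admissible C T F"
  using assms by (simp add: admissible_iff)

lemma admissibleD:
  assumes "admissible C T F"
  shows "id \<in> F" "F \<subseteq> Omega_maps T \<inter> C" "range g \<subseteq> F \<Longrightarrow> approximates T n g"
  using assms by (simp_all add: admissible_iff)

lemma approximates_id: "approximates T n (\<lambda>_. id)"
  using rigid by (simp add: quasi_rigid_def Omega_maps_iff[OF T])

lemma approximates_comp_C:
  assumes "approximates T n g" "approximates T n h" "range h \<subseteq> C"
  shows "approximates T n (\<lambda>i. g i \<circ> h i)"
proof (rule approximates_comp[OF T assms(1,2)])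
  show "open (h i ` U)" if "open U" for i U
    using assms(3) C_Homeo HomeoD(3)[of "h i"] that by blast
qed

lemma approximates_inverse_C:
  assumes "approximates T n g" "range g \<subseteq> C"
  shows "approximates T n (\<lambda>i. inv_into UNIV (g i))"
proof (rule approximates_inverse[OF T assms(1) approximates_id])
  show "continuous_on UNIV (g i)" for i
    using assms(2) C_Homeo HomeoD(1)[of "g i"] by blast
  show "g i (inv_into UNIV (g i) x) = x" for i x
    using assms(2) C_bij by (simp add: bij_is_surj image_subset_iff surj_f_inv_f)
qed

lemma Omega_comp:
  assumes "f \<in> Omega_maps T \<inter> C" "h \<in> Omega_maps T \<inter> C"
  shows "f \<circ> h \<in> Omega_maps T \<inter> C"
proof -
  have fh: "f \<circ> h \<in> C" using assms C_comp by blast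
  have "approximates T n (\<lambda>_. f \<circ> h)" for n
    by (rule approximates_comp_C[of n "\<lambda>_. f" "\<lambda>_. h"]) (use assms Omega_iff in auto)
  then show ?thesis using fh by (simp add: Omega_iff)
qed

lemma Omega_inverse:
  assumes "h \<in> Omega_maps T \<inter> C"
  shows "inv_into UNIV h \<in> Omega_maps T \<inter> C"
proof -
  have hC: "inv_into UNIV h \<in> C" using assms C_inverse by blast
  have "approximates T n (\<lambda>_. inv_into UNIV h)" for n
    by (rule approximates_inverse_C[of n "\<lambda>_. h"]) (use assms Omega_iff in auto)
  then show ?thesis using hC by (simp add: Omega_iff)
qed

lemma Omega_id: "id \<in> Omega_maps T \<inter> C"
  using rigid C_id by (simp add: quasi_rigid_def)

lemma admissible_comp:
  assumes F: "admissible C T F" and F': "admissible C T F'"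
  shows "admissible C T {f \<circ> f' | f f'. f \<in> F \<and> f' \<in> F'}" (is "admissible C T ?FF")
proof (rule admissibleI)
  have "id \<circ> id \<in> ?FF"
    using admissibleD(1)[OF F] admissibleD(1)[OF F'] by blast
  then show "id \<in> ?FF" by simp
  show "?FF \<subseteq> Omega_maps T \<inter> C"
    using admissibleD(2)[OF F] admissibleD(2)[OF F'] Omega_comp by blast
  fix g :: "nat \<Rightarrow> 'a \<Rightarrow> 'a" and n assume "range g \<subseteq> ?FF"
  then have "\<forall>i. \<exists>f f'. f \<in> F \<and> f' \<in> F' \<and> g i = f \<circ> f'" by blast
  then obtain f f' where f: "\<And>i. f i \<in> F" "\<And>i. f' i \<in> F'" "\<And>i. g i = f i \<circ> f' i"
    by metis
  then have "range f \<subseteq> F" "range f' \<subseteq> F'" by auto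
  then have "approximates T n f" "approximates T n f'" "range f' \<subseteq> C"
    using admissibleD(3)[OF F] admissibleD(2,3)[OF F'] by auto
  then have "approximates T n (\<lambda>i. f i \<circ> f' i)" by (rule approximates_comp_C)
  then show "approximates T n g" by (simp only: f(3)[symmetric])
qed

lemma admissible_inverse:
  assumes F: "admissible C T F"
  shows "admissible C T (inv_into UNIV ` F)"
proof (rule admissibleI)
  have "inv_into UNIV id \<in> inv_into UNIV ` F"
    using admissibleD(1)[OF F] by (rule imageI)
  then show "id \<in> inv_into UNIV ` F" by simp
  show "inv_into UNIV ` F \<subseteq> Omega_maps T \<inter> C"
    using admissibleD(2)[OF F] Omega_inverse by blast
  fix g :: "nat \<Rightarrow> 'a \<Rightarrow> 'a" and n assume "range g \<subseteq> inv_into UNIV ` F"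
  then have "\<forall>i. \<exists>f. f \<in> F \<and> g i = inv_into UNIV f" by blast
  then obtain f where f: "\<And>i. f i \<in> F" "\<And>i. g i = inv_into UNIV (f i)"
    by metis
  then have "range f \<subseteq> F" by auto
  then have "approximates T n f" "range f \<subseteq> C"
    using admissibleD(2,3)[OF F] by auto
  then have "approximates T n (\<lambda>i. inv_into UNIV (f i))" by (rule approximates_inverse_C)
  then show "approximates T n g" by (simp only: f(2)[symmetric])
qed

lemma admissible_conjugate:
  assumes F: "admissible C T F" and h: "h \<in> Omega_maps T \<inter> C"
  shows "admissible C T ((\<lambda>f. h \<circ> f \<circ> inv_into UNIV h) ` F)" (is "admissible C T (?c ` F)")
proof (rule admissibleI)
  have "surj h" using C_bij h by (simp add: bij_is_surj)
  then have "?c id = id" by (simp add: surj_iff)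
  then show "id \<in> ?c ` F"
    using imageI[OF admissibleD(1)[OF F], of ?c] by simp
  show "?c ` F \<subseteq> Omega_maps T \<inter> C"
    using admissibleD(2)[OF F] by (intro image_subsetI Omega_comp Omega_inverse h) blast
  fix g :: "nat \<Rightarrow> 'a \<Rightarrow> 'a" and n assume "range g \<subseteq> ?c ` F"
  then have "\<forall>i. \<exists>f. f \<in> F \<and> g i = ?c f" by blast
  then obtain f where f: "\<And>i. f i \<in> F" "\<And>i. g i = ?c (f i)"
    by metis
  have h': "approximates T n (\<lambda>_. h)" "approximates T n (\<lambda>_. inv_into UNIV h)"
    using h Omega_inverse[OF h] Omega_iff by auto
  have "range f \<subseteq> F" using f(1) by auto
  then have "approximates T n f" "range f \<subseteq> C"
    using admissibleD(2,3)[OF F] by auto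
  then have "approximates T n (\<lambda>i. h \<circ> f i)" by (rule approximates_comp_C[OF h'(1)])
  then have "approximates T n (\<lambda>i. h \<circ> f i \<circ> inv_into UNIV h)"
    using Omega_inverse[OF h] by (intro approximates_comp_C[OF _ h'(2)]) auto
  then show "approximates T n g" by (simp only: f(2)[symmetric])
qed

lemma admissible_directed:
  assumes F: "admissible C T F" and F': "admissible C T F'"
  obtains F'' where "admissible C T F''" "F \<subseteq> F''" "F' \<subseteq> F''"
proof (rule that[OF admissible_comp[OF F F']])
  have id: "id \<in> F" "id \<in> F'" using admissibleD(1) F F' by auto
  have "f = f \<circ> id \<and> f = id \<circ> f" for f :: "'a \<Rightarrow> 'a" by simp
  then show "F \<subseteq> {f \<circ> f' | f f'. f \<in> F \<and> f' \<in> F'}" "F' \<subseteq> {f \<circ> f' | f f'. f \<in> F \<and> f' \<in> F'}"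
    using id by blast+
qed

lemma admissible_singleton_id: "admissible C T {id}"
proof (rule admissibleI)
  show "{id} \<subseteq> Omega_maps T \<inter> C" using Omega_id by blast
  fix g :: "nat \<Rightarrow> 'a \<Rightarrow> 'a" and n assume "range g \<subseteq> {id}"
  then have "g = (\<lambda>_. id)" by (intro ext[of g]) blast
  then show "approximates T n g" using approximates_id by simp
qed simp

lemma admissible_Union: "admissible C T (\<Union>{F. admissible C T F})" (is "admissible C T ?G")
proof (rule admissibleI)
  show "id \<in> ?G" using admissible_singleton_id by blast
  show "?G \<subseteq> Omega_maps T \<inter> C" using admissibleD(2) by (intro Union_least) simp
  fix g :: "nat \<Rightarrow> 'a \<Rightarrow> 'a" and n assume g: "range g \<subseteq> ?G"
  \<comment> \<open>Finitely many members of the union lie in a single admissible collection.\<close>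
  have "\<exists>F. admissible C T F \<and> (\<forall>i<n. g i \<in> F)"
  proof (induction n)
    case 0
    then show ?case using admissible_singleton_id by auto
  next
    case (Suc n)
    then obtain F where F: "admissible C T F" "\<forall>i<n. g i \<in> F" by blast
    obtain F' where F': "admissible C T F'" "g n \<in> F'" using g by blast
    obtain F'' where F'': "admissible C T F''" "F \<subseteq> F''" "F' \<subseteq> F''"
      using admissible_directed[OF F(1) F'(1)] .
    then have "\<forall>i<Suc n. g i \<in> F''" using F(2) F'(2) by (auto simp: less_Suc_eq)
    with F''(1) show ?case by blast
  qed
  then obtain F where F: "admissible C T F" "\<forall>i<n. g i \<in> F" by blast
  define g' where "g' i = (if i < n then g i else id)" for i
  have "range g' \<subseteq> F" using F(2) admissibleD(1)[OF F(1)] by (auto simp: g'_def)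
  then have "approximates T n g'" by (rule admissibleD(3)[OF F(1)])
  then show "approximates T n g" by (simp add: approximates_def g'_def)
qed

text \<open>The largest admissible collection is the unique maximal one, so the definite description denotes it.\<close>

lemma maximal_admissible: "(THE F. is_maximal_collection (admissible C T) F) = \<Union>{F. admissible C T F}"
    (is "_ = ?G")
proof (rule the_equality)
  have greatest: "F \<subseteq> ?G" if "admissible C T F" for F
    using that by blast
  then show "is_maximal_collection (admissible C T) ?G"
    unfolding is_maximal_collection_def using admissible_Union by (intro conjI allI impI) auto
  show "F = ?G" if "is_maximal_collection (admissible C T) F" for F
    using that greatest admissible_Union unfolding is_maximal_collection_def by metis
qed

lemma group_Omega: "group (comp_monoid (Omega_maps T \<inter> C))"
proof (rule groupI)
  fix h assume "h \<in> carrier (comp_monoid (Omega_maps T \<inter> C))"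
  then have h: "h \<in> Omega_maps T \<inter> C" by (simp add: comp_monoid_def)
  then have "inv_into UNIV h \<circ> h = id" using C_bij by (simp add: bij_is_inj)
  then show "\<exists>y\<in>carrier (comp_monoid (Omega_maps T \<inter> C)).
      y \<otimes>\<^bsub>comp_monoid (Omega_maps T \<inter> C)\<^esub> h = \<one>\<^bsub>comp_monoid (Omega_maps T \<inter> C)\<^esub>"
    using Omega_inverse[OF h] by (auto simp: comp_monoid_def)
qed (use Omega_comp Omega_id in \<open>auto simp: comp_monoid_def o_assoc\<close>)

lemma m_inv_Omega:
  assumes h: "h \<in> Omega_maps T \<inter> C"
  shows "m_inv (comp_monoid (Omega_maps T \<inter> C)) h = inv_into UNIV h"
proof (rule group.inv_equality[OF group_Omega])
  show "inv_into UNIV h \<otimes>\<^bsub>comp_monoid (Omega_maps T \<inter> C)\<^esub> h = \<one>\<^bsub>comp_monoid (Omega_maps T \<inter> C)\<^esub>"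
    using h C_bij by (simp add: comp_monoid_def bij_is_inj)
qed (use h Omega_inverse[OF h] in \<open>auto simp: comp_monoid_def\<close>)

theorem normal_maximal_admissible:
  "normal (THE F. is_maximal_collection (admissible C T) F) (comp_monoid (Omega_maps T \<inter> C))"
proof -
  define G where "G = \<Union>{F. admissible C T F}"
  let ?M = "comp_monoid (Omega_maps T \<inter> C)"
  have G: "admissible C T G" and greatest: "\<And>F. admissible C T F \<Longrightarrow> F \<subseteq> G"
    using admissible_Union unfolding G_def by auto
  have sub: "G \<subseteq> Omega_maps T \<inter> C"
    using admissibleD(2)[OF G] .
  have "subgroup G ?M"
  proof (rule group.subgroupI[OF group_Omega])
    show "G \<subseteq> carrier ?M" using sub by (simp add: comp_monoid_def)
    show "G \<noteq> {}" using admissibleD(1)[OF G] by blast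
    show "m_inv ?M a \<in> G" if "a \<in> G" for a
    proof -
      have "inv_into UNIV a \<in> G"
        using greatest[OF admissible_inverse[OF G]] that by blast
      moreover have "a \<in> Omega_maps T \<inter> C" using that sub by blast
      ultimately show ?thesis by (simp only: m_inv_Omega)
    qed
    show "a \<otimes>\<^bsub>?M\<^esub> b \<in> G" if "a \<in> G" "b \<in> G" for a b
    proof -
      have "a \<circ> b \<in> G"
        using greatest[OF admissible_comp[OF G G]] that by blast
      then show ?thesis by (simp add: comp_monoid_def)
    qed
  qed
  moreover have "x \<otimes>\<^bsub>?M\<^esub> h \<otimes>\<^bsub>?M\<^esub> m_inv ?M x \<in> G" if x: "x \<in> carrier ?M" and h: "h \<in> G" for x h
  proof -
    have x': "x \<in> Omega_maps T \<inter> C" using x by (simp add: comp_monoid_def)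
    have "x \<circ> h \<circ> inv_into UNIV x \<in> G"
      using greatest[OF admissible_conjugate[OF G x']] h by blast
    then show ?thesis using m_inv_Omega[OF x'] by (simp add: comp_monoid_def)
  qed
  ultimately show ?thesis
    unfolding maximal_admissible group.normal_inv_iff[OF group_Omega] G_def[symmetric] by blast
qed

end


section \<open>The linear setting\<close>

lemma GL_subset_Homeo: "GL smul \<subseteq> Homeo"
proof
  fix A assume "A \<in> GL smul"
  then obtain B where "continuous_on UNIV A" "continuous_on UNIV B" "A \<circ> B = id" "B \<circ> A = id"
    unfolding GL_def operators_def by blast
  then have "homeomorphism UNIV UNIV A B"
    by (auto simp: homeomorphism_def fun_eq_iff image_iff) metis+
  then show "A \<in> Homeo" unfolding Homeo_def by blast
qed

lemma homeo_group_GL: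
  fixes smul :: "'k::real_normed_field \<Rightarrow> 'a::{polish_space, topological_ab_group_add} \<Rightarrow> 'a"
  assumes "vector_space smul"
  shows "homeo_group (GL smul)"
proof -
  have comp: "A \<circ> B \<in> operators smul" if "A \<in> operators smul" "B \<in> operators smul" for A B
  proof -
    have "Vector_Spaces.linear smul smul (A \<circ> B)" "continuous_on UNIV (A \<circ> B)"
      using that Vector_Spaces.linear_compose[of smul smul B smul A]
        continuous_on_compose[of UNIV B A] continuous_on_subset[of UNIV A]
      unfolding operators_def by auto
    then show ?thesis by (simp add: operators_def)
  qed
  have id: "id \<in> operators smul"
    using vector_space.linear_id[OF assms] by (simp add: operators_def id_def)
  have "A \<circ> B \<in> GL smul" if A: "A \<in> GL smul" and B: "B \<in> GL smul" for A B
  proof -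
    obtain A' B' where *: "A' \<in> operators smul" "A \<circ> A' = id" "A' \<circ> A = id"
        "B' \<in> operators smul" "B \<circ> B' = id" "B' \<circ> B = id"
      using A B unfolding GL_def by blast
    have "(A \<circ> B) \<circ> (B' \<circ> A') = A \<circ> (B \<circ> B') \<circ> A'" "(B' \<circ> A') \<circ> (A \<circ> B) = B' \<circ> (A' \<circ> A) \<circ> B"
      by (simp_all only: o_assoc)
    then have "(A \<circ> B) \<circ> (B' \<circ> A') = id" "(B' \<circ> A') \<circ> (A \<circ> B) = id"
      using * by simp_all
    moreover have "A \<circ> B \<in> operators smul" "B' \<circ> A' \<in> operators smul"
      using A B *(1,4) comp unfolding GL_def by simp_all
    ultimately show ?thesis
      unfolding GL_def by blast
  qed
  moreover have "inv_into UNIV A \<in> GL smul" if A: "A \<in> GL smul" for A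
  proof -
    obtain B where *: "B \<in> operators smul" "A \<circ> B = id" "B \<circ> A = id"
      using A unfolding GL_def by blast
    then have "inv_into UNIV A = B" by (metis inv_unique_comp)
    then show ?thesis using A * unfolding GL_def by blast
  qed
  moreover have "id \<in> GL smul" using id unfolding GL_def by auto
  ultimately show ?thesis
    using GL_subset_Homeo unfolding homeo_group_def by blast
qed

lemma power_linear_power_map:
  assumes "\<And>i. i < n \<Longrightarrow> Vector_Spaces.linear smul smul (g i)"
  shows "power_linear smul n (power_map n g)"
proof -
  have "g i (u + v) = g i u + g i v" "g i (smul c u) = smul c (g i u)" if "i < n" for i c u v
    using assms[OF that] unfolding Vector_Spaces.linear_iff by auto
  then show ?thesis
    unfolding power_linear_def power_map_def by (auto simp: fun_eq_iff restrict_def)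
qed

lemma simultaneously_approximated_ops_iff:
  fixes smul :: "'k::real_normed_field \<Rightarrow> 'a::{polish_space, topological_ab_group_add} \<Rightarrow> 'a"
  assumes "F \<subseteq> operators smul"
  shows "simultaneously_approximated_ops smul T F \<longleftrightarrow> simultaneously_approximated T F"
proof -
  have lin: "power_linear smul n (power_map n g)" if "\<forall>i<n. g i \<in> F" for n g
    using that assms by (intro power_linear_power_map) (auto simp: operators_def)
  have cont: "\<forall>h\<in>F. continuous_on UNIV h"
    using assms by (auto simp: operators_def)
  show ?thesis
    unfolding simultaneously_approximated_ops_def simultaneously_approximated_def
    by (simp add: assms cont lin)
qed

lemma Omega_ops_Int_GL: "Omega_ops smul T \<inter> GL smul = Omega_maps T \<inter> GL smul"
  by (auto simp: Omega_ops_def GL_def)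

lemma G_ops_eq:
  fixes smul :: "'k::real_normed_field \<Rightarrow> 'a::{polish_space, topological_ab_group_add} \<Rightarrow> 'a"
  shows "G_ops smul T = (THE F. is_maximal_collection (admissible (GL smul) T) F)"
proof -
  have "(id \<in> F \<and> simultaneously_approximated_ops smul T F \<and> F \<subseteq> Omega_ops smul T \<inter> GL smul) =
      admissible (GL smul) T F" for F
  proof (cases "F \<subseteq> operators smul")
    case True
    then show ?thesis
      by (simp only: simultaneously_approximated_ops_iff Omega_ops_Int_GL admissible_def)
  next
    case False
    then have "\<not> F \<subseteq> Omega_maps T \<inter> GL smul" by (auto simp: GL_def)
    then show ?thesis
      by (simp only: Omega_ops_Int_GL admissible_def simp_thms)
  qed
  then show ?thesis unfolding G_ops_def by (simp only:)
qed

theorem proposition3p10: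
  fixes T :: "'a::polish_space \<Rightarrow> 'a"
    and smul :: "'k::real_normed_field \<Rightarrow> 'b::{polish_space, topological_ab_group_add} \<Rightarrow> 'b"
    and S :: "'b \<Rightarrow> 'b"
  shows "(continuous_on UNIV T \<and> quasi_rigid T \<longrightarrow>
            normal (G_maps T) (comp_monoid (Omega_maps T \<inter> Homeo))) \<and>
         (separable_F_space smul \<and> S \<in> operators smul \<and> quasi_rigid_op smul S \<longrightarrow>
            normal (G_ops smul S) (comp_monoid (Omega_ops smul S \<inter> GL smul)))"
proof (intro conjI impI; elim conjE)
  assume "continuous_on UNIV T" "quasi_rigid T"
  then interpret quasi_rigid_system T Homeo
    using homeo_group_Homeo by unfold_locales
  show "normal (G_maps T) (comp_monoid (Omega_maps T \<inter> Homeo))"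
    using normal_maximal_admissible unfolding G_maps_def admissible_def[abs_def] .
next
  assume S: "separable_F_space smul" "S \<in> operators smul" "quasi_rigid_op smul S"
  interpret quasi_rigid_system S "GL smul"
    using S homeo_group_GL[of smul] unfolding separable_F_space_def
    by unfold_locales (auto simp: operators_def quasi_rigid_op_def quasi_rigid_def Omega_ops_def)
  show "normal (G_ops smul S) (comp_monoid (Omega_ops smul S \<inter> GL smul))"
    using normal_maximal_admissible unfolding G_ops_eq Omega_ops_Int_GL .
qed

end
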